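(* Let $\mathbf{J}\sim\mathcal{N}(\mu,C)$ on $\mathbb{R}^d$, where $C$ is the Matérn covariance with scale $s>0$, variance $\sigma^2>0$ and smoothness $\nu=p+\tfrac12$ with $p\in\{1,2\}$. Let $\Theta:=\frac{\|\nabla\mathbf{J}(w)\|}{\mu-\mathbf{J}(w)}>0$. Then the RFD step size is given as follows. If $p=1$: $$\eta^*=\frac{s}{\sqrt3}\,\frac{1}{1+\frac{\sqrt3}{s\Theta}}.$$ If $p=2$: $$\eta^*=\frac{s}{\sqrt5}\,\frac{(1-\zeta)+\sqrt{4+(1+\zeta)^2}}{2(1+\zeta)},\qquad \zeta:=\frac{\sqrt5}{3s\Theta}.$$
   Context: $\mathbf{J}\sim\mathcal{N}(\mu,C)$ means that $\mathbf{J}$ is a Gaussian random function on $\mathbb{R}^d$ (with differentiable sample paths) with $\mathbb{E}[\mathbf{J}(w)]=\mu$ and $\operatorname{Cov}(\mathbf{J}(w),\mathbf{J}(\tilde w))=C\bigl(\tfrac{\|w-\tilde w\|^2}{2}\bigr)$. For $\nu=p+\tfrac12$, $p\in\mathbb{N}_0$, the Matérn covariance is $$C\bigl(\tfrac{\|x-y\|^2}{2}\bigr)=\sigma^2 e^{-\frac{\sqrt{2\nu}\|x-y\|}{s}}\frac{p!}{(2p)!}\sum_{k=0}^p\frac{(2p-k)!}{(p-k)!\,k!}\Bigl(\frac{2\sqrt{2\nu}}{s}\|x-y\|\Bigr)^k .$$ The point $w$ is deterministic with $\mathbf{J}(w)<\mu$ and $\nabla\mathbf{J}(w)\ne0$.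 The RFD step size is $$\eta^*:=\operatorname*{argmin}_{\eta\in\mathbb{R}}\ -\frac{C(\eta^2/2)}{C(0)}-\eta\,\frac{C'(\eta^2/2)}{C'(0)}\,\Theta ,$$ where $C'$ is the derivative of $C$ on $[0,\infty)$ (one-sided at $0$). *)

theory Defs
  imports "HOL-Probability.Probability"
begin

text \<open>Univariate normal laws including the degenerate ones (variance zero), as needed for
  linear combinations of jointly Gaussian variables.\<close>

definition gaussian_rv :: "'w measure \<Rightarrow> ('w \<Rightarrow> real) \<Rightarrow> bool" where
  "gaussian_rv M X \<longleftrightarrow> X \<in> borel_measurable M \<and>
     (\<exists>m \<sigma>. (\<sigma> > 0 \<and> distributed M lborel X (normal_density m \<sigma>)) \<or> (AE \<omega> in M. X \<omega> = m))"

definition covariance :: "'w measure \<Rightarrow> ('w \<Rightarrow> real) \<Rightarrow> ('w \<Rightarrow> real) \<Rightarrow> real" where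
  "covariance M X Y = (LINT \<omega>|M. (X \<omega> - (LINT \<omega>'|M. X \<omega>')) * (Y \<omega> - (LINT \<omega>'|M. Y \<omega>')))"

text \<open>The random function is written \<open>J \<omega> x\<close>, so that \<open>J \<omega>\<close> is a sample path. Gaussianity means
  that all finite-dimensional marginals are jointly normal, i.e. all their linear combinations
  are normal.\<close>

definition gaussian_random_function :: "'w measure \<Rightarrow> ('w \<Rightarrow> real ^ 'n \<Rightarrow> real) \<Rightarrow> bool" where
  "gaussian_random_function M J \<longleftrightarrow>
     (\<forall>A c. finite A \<longrightarrow> gaussian_rv M (\<lambda>\<omega>. \<Sum>x\<in>A. c x * J \<omega> x))"

text \<open>\<open>J \<sim> \<N>(\<mu>, C)\<close>. The covariance kernel \<open>C\<close> takes half the squared distance as argument, so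
  only its values on the nonnegative reals matter.\<close>

definition isotropic_gaussian_function ::
  "'w measure \<Rightarrow> ('w \<Rightarrow> real ^ 'n \<Rightarrow> real) \<Rightarrow> real \<Rightarrow> (real \<Rightarrow> real) \<Rightarrow> bool" where
  "isotropic_gaussian_function M J \<mu> C \<longleftrightarrow>
     prob_space M \<and>
     gaussian_random_function M J \<and>
     (\<forall>\<omega>\<in>space M. \<forall>x. J \<omega> differentiable (at x)) \<and>
     (\<forall>x. (LINT \<omega>|M. J \<omega> x) = \<mu>) \<and>
     (\<forall>x y. covariance M (\<lambda>\<omega>. J \<omega> x) (\<lambda>\<omega>. J \<omega> y) = C ((norm (x - y))\<^sup>2 / 2))"

text \<open>The Matern covariance of smoothness \<open>\<nu> = p + 1/2\<close>, with scale \<open>s\<close> and variance \<open>\<sigma>\<^sup>2\<close>,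
  first as a function of the distance \<open>r\<close>, then as a function of \<open>x = r\<^sup>2 / 2\<close>.\<close>

definition matern_radial :: "nat \<Rightarrow> real \<Rightarrow> real \<Rightarrow> real \<Rightarrow> real" where
  "matern_radial p s \<sigma> r =
     (let \<nu> = real p + 1 / 2 in
       \<sigma>\<^sup>2 * exp (- (sqrt (2 * \<nu>) * r / s)) * (fact p / fact (2 * p)) *
       (\<Sum>k=0..p. fact (2 * p - k) / (fact (p - k) * fact k) * (2 * sqrt (2 * \<nu>) / s * r) ^ k))"

definition matern :: "nat \<Rightarrow> real \<Rightarrow> real \<Rightarrow> real \<Rightarrow> real" where
  "matern p s \<sigma> x = matern_radial p s \<sigma> (sqrt (2 * x))"

lemma matern_half_sq_dist:
  "matern p s \<sigma> ((norm (x - y))\<^sup>2 / 2) = matern_radial p s \<sigma> (norm (x - y))"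
  by (simp add: matern_def)

text \<open>The derivative of a kernel on \<open>[0,\<infinity>)\<close>, one-sided at \<open>0\<close>.\<close>

definition kernel_deriv :: "(real \<Rightarrow> real) \<Rightarrow> real \<Rightarrow> real" where
  "kernel_deriv C x = vector_derivative C (at x within {0..})"

definition gradient :: "('a::real_inner \<Rightarrow> real) \<Rightarrow> 'a \<Rightarrow> 'a" where
  "gradient f x = (THE g. GDERIV f x :> g)"

definition rfd_objective :: "(real \<Rightarrow> real) \<Rightarrow> real \<Rightarrow> real \<Rightarrow> real" where
  "rfd_objective C \<Theta> \<eta> =
     - (C (\<eta>\<^sup>2 / 2) / C 0) - \<eta> * (kernel_deriv C (\<eta>\<^sup>2 / 2) / kernel_deriv C 0) * \<Theta>"

text \<open>Membership in the set of global minimizers over the whole real line. That this set is a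
  singleton, so that one may speak of the step size, is a property to be shown.\<close>

definition is_rfd_step_size :: "(real \<Rightarrow> real) \<Rightarrow> real \<Rightarrow> real \<Rightarrow> bool" where
  "is_rfd_step_size C \<Theta> \<eta> \<longleftrightarrow> is_arg_min (rfd_objective C \<Theta>) (\<lambda>_. True) \<eta>"

end

theory Submission
  imports Defs
begin

text \<open>Once \<open>\<Theta> > 0\<close> is known, the claim concerns the minimization of an explicit function on the
  real line. At distance \<open>r = \<bar>\<eta>\<bar>\<close> the Matern kernel is a polynomial in \<open>r\<close> times \<open>exp (- a r)\<close>,
  where \<open>a = sqrt (2 \<nu>) / s\<close>. A kernel of the form \<open>C x = \<phi> (sqrt (2 x))\<close> has
  derivative \<open>\<phi>' r / r\<close> at \<open>x = r\<^sup>2 / 2 > 0\<close>. For \<open>p = 1\<close> and \<open>p = 2\<close> the factor \<open>r\<close> cancels, so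
  the one-sided derivative at \<open>0\<close> is the limit of the derivatives to its right
  (\<open>kernel_deriv_radial\<close>).

  In the objective the term without \<open>\<Theta>\<close> is even in \<open>\<eta>\<close> and the other one is odd and decreases the
  value for \<open>\<eta> > 0\<close>. A negative \<open>\<eta>\<close> is thus worse than its mirror image, and only
  \<open>\<eta> \<ge> 0\<close> matters. There the derivative of the objective is \<open>exp (- a \<eta>)\<close> times a
  polynomial: linear for \<open>p = 1\<close>, and for \<open>p = 2\<close> quadratic with positive leading and negative
  constant coefficient. In both cases it has exactly one positive zero and changes sign there
  from negative to positive, so that this zero is the only global minimizer
  (\<open>is_arg_min_iff_sign_change\<close>). It is the claimed step size.\<close>

section \<open>Derivatives of radial kernels\<close>

text \<open>L'Hopital's rule, applied to the difference quotient at \<open>a\<close>.\<close>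

lemma has_real_derivative_right_limit:
  fixes f f' :: "real \<Rightarrow> real"
  assumes cont: "continuous (at_right a) f"
    and deriv: "\<And>x. x > a \<Longrightarrow> (f has_real_derivative f' x) (at x)"
    and lim: "(f' \<longlongrightarrow> L) (at_right a)"
  shows "(f has_real_derivative L) (at a within {a..})"
proof -
  have right: "eventually (\<lambda>x. x > a) (at_right a)"
    by (simp add: eventually_at_filter)
  have "((\<lambda>x. (f x - f a) / (x - a)) \<longlongrightarrow> L) (at_right a)"
  proof (rule lhopital_right)
    show "((\<lambda>x. f x - f a) \<longlongrightarrow> 0) (at_right a)"
      using cont by (simp add: continuous_within LIM_zero)
    show "((\<lambda>x. x - a) \<longlongrightarrow> 0) (at_right a)"
      by (intro LIM_zero tendsto_ident_at)
    show "\<forall>\<^sub>F x in at_right a. x - a \<noteq> 0"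
      using right by eventually_elim auto
    show "\<forall>\<^sub>F x in at_right a. (1::real) \<noteq> 0" by simp
    show "\<forall>\<^sub>F x in at_right a. ((\<lambda>x. f x - f a) has_real_derivative f' x) (at x)"
      using right by eventually_elim (auto intro!: derivative_eq_intros deriv)
    show "\<forall>\<^sub>F x in at_right a. ((\<lambda>x. x - a) has_real_derivative 1) (at x)"
      by (auto intro!: always_eventually derivative_eq_intros)
    show "((\<lambda>x. f' x / 1) \<longlongrightarrow> L) (at_right a)" using lim by simp
  qed
  thus ?thesis
    by (simp add: has_field_derivative_iff at_within_Ici_at_right)
qed

text \<open>For \<open>r = sqrt (2 x)\<close> one has \<open>dr/dx = 1 / r\<close>, which cancels the factor \<open>r\<close> in the derivative
  of the profile.\<close>

lemma kernel_deriv_radial: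
  fixes \<phi> \<psi> :: "real \<Rightarrow> real"
  assumes deriv: "\<And>r. (\<phi> has_real_derivative r * \<psi> r) (at r)"
    and cont: "isCont \<psi> 0" and "x \<ge> 0"
  shows "kernel_deriv (\<lambda>x. \<phi> (sqrt (2 * x))) x = \<psi> (sqrt (2 * x))"
proof -
  let ?C = "\<lambda>x. \<phi> (sqrt (2 * x))"
  have pos: "(?C has_real_derivative \<psi> (sqrt (2 * y))) (at y)" if "y > 0" for y
  proof -
    have "((\<lambda>y. sqrt (2 * y)) has_real_derivative 1 / sqrt (2 * y)) (at y)"
      using that by (auto intro!: derivative_eq_intros simp: field_simps)
    from DERIV_chain2[OF deriv this] show ?thesis using that by simp
  qed
  have lim0: "((\<lambda>y. g (sqrt (2 * y))) \<longlongrightarrow> g 0) (at_right 0)" if "isCont g 0" for g :: "real \<Rightarrow> real"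
  proof -
    have "isCont (\<lambda>y. g (sqrt (2 * y))) 0"
      by (rule isCont_o2) (use that in \<open>auto intro!: continuous_intros\<close>)
    thus ?thesis
      by (auto simp: isCont_def intro: tendsto_mono[OF at_le])
  qed
  have "(?C has_real_derivative \<psi> (sqrt (2 * x))) (at x within {0..})"
  proof (cases "x = 0")
    case True
    have "(?C has_real_derivative \<psi> 0) (at 0 within {0..})"
      by (rule has_real_derivative_right_limit[OF _ pos lim0[OF cont]])
        (use lim0[of \<phi>] DERIV_isCont[OF deriv] in \<open>auto simp: continuous_within\<close>)
    thus ?thesis using True by simp
  next
    case False
    thus ?thesis
      using pos[of x] \<open>x \<ge> 0\<close> by (auto intro: has_field_derivative_at_within)
  qed
  moreover have "at x within {0..} \<noteq> bot"
  proof
    assume "at x within {0..} = bot"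
    moreover have "at_right x \<le> at x within {0..}"
      using \<open>x \<ge> 0\<close> by (intro at_le) auto
    ultimately show False
      by (simp add: bot_unique)
  qed
  ultimately show ?thesis
    unfolding kernel_deriv_def
    by (intro vector_derivative_within) (auto simp: has_real_derivative_iff_has_vector_derivative)
qed

section \<open>A criterion for a unique global minimizer\<close>

text \<open>The objectives below contain \<open>\<bar>\<eta>\<bar>\<close>. The function \<open>G\<close> extends their branch on the nonnegative
  half-line smoothly to the whole line, so that no one-sided derivative at \<open>0\<close> is needed.\<close>

lemma is_arg_min_iff_sign_change:
  fixes F G G' :: "real \<Rightarrow> real"
  assumes "t > 0"
    and mirror: "\<And>\<eta>. \<eta> > 0 \<Longrightarrow> F \<eta> < F (- \<eta>)"
    and FG: "\<And>\<eta>. \<eta> \<ge> 0 \<Longrightarrow> F \<eta> = G \<eta>"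
    and deriv: "\<And>\<eta>. (G has_real_derivative G' \<eta>) (at \<eta>)"
    and neg: "\<And>\<eta>. 0 < \<eta> \<Longrightarrow> \<eta> < t \<Longrightarrow> G' \<eta> < 0"
    and pos: "\<And>\<eta>. t < \<eta> \<Longrightarrow> G' \<eta> > 0"
  shows "is_arg_min F (\<lambda>_. True) \<eta> \<longleftrightarrow> \<eta> = t"
proof -
  have cont: "continuous_on A G" for A
    using deriv by (meson DERIV_isCont continuous_at_imp_continuous_on)
  have nonneg: "F t < F y" if "y \<ge> 0" "y \<noteq> t" for y
  proof (cases "y < t")
    case True
    have "G t < G y"
      by (rule DERIV_neg_imp_decreasing_open[OF True _ cont])
        (use neg deriv that in \<open>meson order.strict_trans1\<close>)
    thus ?thesis using FG that \<open>t > 0\<close> by simp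
  next
    case False
    hence "t < y" using that by simp
    have "G t < G y"
      by (rule DERIV_pos_imp_increasing_open[OF \<open>t < y\<close> _ cont]) (use pos deriv in meson)
    thus ?thesis using FG that \<open>t > 0\<close> by simp
  qed
  have min: "F t < F y" if "y \<noteq> t" for y
  proof (cases "y \<ge> 0")
    case False
    have "F t \<le> F (- y)" using nonneg[of "- y"] False by (cases "- y = t") auto
    also have "\<dots> < F y" using mirror[of "- y"] False by simp
    finally show ?thesis .
  qed (use nonneg that in auto)
  show ?thesis
    unfolding is_arg_min_def using min by (metis less_asym less_irrefl)
qed

section \<open>The objective for the Matern kernels\<close>

lemma matern_1:
  "matern 1 s \<sigma> = (\<lambda>x. \<sigma>\<^sup>2 * exp (- (sqrt 3 / s * sqrt (2 * x))) * (1 + sqrt 3 / s * sqrt (2 * x)))"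
  by (simp add: fun_eq_iff matern_def matern_radial_def Let_def numeral_2_eq_2 field_simps)

lemma matern_2:
  "matern 2 s \<sigma> = (\<lambda>x. \<sigma>\<^sup>2 * exp (- (sqrt 5 / s * sqrt (2 * x))) *
     (1 + sqrt 5 / s * sqrt (2 * x) + (sqrt 5 / s * sqrt (2 * x))\<^sup>2 / 3))"
proof -
  have poly: "fact 2 / fact (2 * 2) *
      (\<Sum>k=0..2. fact (2 * 2 - k) / (fact (2 - k) * fact k) * (2 * z) ^ k) = 1 + z + z\<^sup>2 / 3"
    for z :: real
    by (simp add: numeral_eq_Suc field_simps)
  have nu: "2 * (real 2 + 1 / 2) = 5" by simp
  have scale: "2 * c / s * r = 2 * (c / s * r)" for c r :: real by simp
  show ?thesis
    unfolding matern_def matern_radial_def Let_def nu scale mult.assoc poly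
    by simp
qed

lemma rfd_objective_matern_1:
  assumes "s > 0" "\<sigma>\<^sup>2 > 0"
  defines "a \<equiv> sqrt 3 / s"
  shows "rfd_objective (matern 1 s \<sigma>) \<Theta> \<eta> =
    - exp (- a * \<bar>\<eta>\<bar>) * (1 + a * \<bar>\<eta>\<bar>) - \<eta> * exp (- a * \<bar>\<eta>\<bar>) * \<Theta>"
proof -
  have "a > 0" using assms by simp
  have kd: "kernel_deriv (matern 1 s \<sigma>) x = - (\<sigma>\<^sup>2 * a\<^sup>2) * exp (- (a * sqrt (2 * x)))" if "x \<ge> 0" for x
    unfolding matern_1 a_def[symmetric]
    by (rule kernel_deriv_radial[where \<phi> = "\<lambda>r. \<sigma>\<^sup>2 * exp (- (a * r)) * (1 + a * r)"
          and \<psi> = "\<lambda>r. - (\<sigma>\<^sup>2 * a\<^sup>2) * exp (- (a * r))"])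
      (use that in \<open>auto intro!: derivative_eq_intros continuous_intros
        simp: algebra_simps power2_eq_square\<close>)
  show ?thesis
    unfolding rfd_objective_def using assms(2) \<open>a > 0\<close>
    by (simp add: kd del: One_nat_def) (simp add: matern_1 a_def[symmetric] del: One_nat_def)
qed

lemma rfd_objective_matern_2:
  assumes "s > 0" "\<sigma>\<^sup>2 > 0"
  defines "a \<equiv> sqrt 5 / s"
  shows "rfd_objective (matern 2 s \<sigma>) \<Theta> \<eta> =
    - exp (- a * \<bar>\<eta>\<bar>) * (1 + a * \<bar>\<eta>\<bar> + (a * \<bar>\<eta>\<bar>)\<^sup>2 / 3) - \<eta> * (exp (- a * \<bar>\<eta>\<bar>) * (1 + a * \<bar>\<eta>\<bar>)) * \<Theta>"
proof -
  have "a > 0" using assms by simp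
  have kd: "kernel_deriv (matern 2 s \<sigma>) x =
      - (\<sigma>\<^sup>2 * a\<^sup>2 / 3) * (exp (- (a * sqrt (2 * x))) * (1 + a * sqrt (2 * x)))" if "x \<ge> 0" for x
    unfolding matern_2 a_def[symmetric]
    by (rule kernel_deriv_radial[where \<phi> = "\<lambda>r. \<sigma>\<^sup>2 * exp (- (a * r)) * (1 + a * r + (a * r)\<^sup>2 / 3)"
          and \<psi> = "\<lambda>r. - (\<sigma>\<^sup>2 * a\<^sup>2 / 3) * (exp (- (a * r)) * (1 + a * r))"])
      (use that in \<open>auto intro!: derivative_eq_intros continuous_intros
        simp: field_simps power2_eq_square\<close>)
  show ?thesis
    unfolding rfd_objective_def using assms(2) \<open>a > 0\<close>
    by (simp add: kd) (simp add: matern_2 a_def[symmetric])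
qed

section \<open>The step sizes\<close>

lemma rfd_step_size_matern_1:
  assumes "s > 0" "\<sigma>\<^sup>2 > 0" "\<Theta> > 0"
  shows "is_rfd_step_size (matern 1 s \<sigma>) \<Theta> \<eta> \<longleftrightarrow>
    \<eta> = s / sqrt 3 * (1 / (1 + sqrt 3 / (s * \<Theta>)))"
proof -
  define a where "a = sqrt 3 / s"
  define t where "t = \<Theta> / (a * (a + \<Theta>))"
  have a: "a > 0" using assms by (simp add: a_def)
  have t: "t > 0" using a assms by (simp add: t_def)
  have root: "a * (a + \<Theta>) * t = \<Theta>" using a assms by (simp add: t_def)
  have ap: "a * (a + \<Theta>) > 0" using a assms by simp
  have "s / sqrt 3 * (1 / (1 + sqrt 3 / (s * \<Theta>))) = 1 / a * (1 / (1 + a / \<Theta>))"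
    by (simp add: a_def)
  also have "\<dots> = t" using a assms by (simp add: t_def field_simps)
  finally have t_eq: "s / sqrt 3 * (1 / (1 + sqrt 3 / (s * \<Theta>))) = t" .
  note obj = rfd_objective_matern_1[OF assms(1,2), folded a_def]
  show ?thesis
    unfolding is_rfd_step_size_def t_eq
  proof (rule is_arg_min_iff_sign_change[OF t])
    show "rfd_objective (matern 1 s \<sigma>) \<Theta> y < rfd_objective (matern 1 s \<sigma>) \<Theta> (- y)" if "y > 0" for y
    proof -
      have "y * exp (- a * y) * \<Theta> > 0" using that assms by simp
      thus ?thesis using that by (simp add: obj del: One_nat_def)
    qed
    show "rfd_objective (matern 1 s \<sigma>) \<Theta> y = - exp (- a * y) * (1 + (a + \<Theta>) * y)" if "y \<ge> 0" for y
      using that by (simp add: obj algebra_simps del: One_nat_def)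
    show "((\<lambda>y. - exp (- a * y) * (1 + (a + \<Theta>) * y)) has_real_derivative
        exp (- a * y) * (a * (a + \<Theta>) * (y - t))) (at y)" for y
      unfolding right_diff_distrib root
      by (auto intro!: derivative_eq_intros simp: algebra_simps)
    show "exp (- a * y) * (a * (a + \<Theta>) * (y - t)) < 0" if "y < t" for y
      using that ap by (intro mult_pos_neg) auto
    show "exp (- a * y) * (a * (a + \<Theta>) * (y - t)) > 0" if "t < y" for y
      using that a assms by (intro mult_pos_pos) auto
  qed
qed

text \<open>In the variable \<open>x = a \<eta>\<close> the derivative of the objective is a positive multiple of
  \<open>(1 + \<zeta>) x\<^sup>2 - (1 - \<zeta>) x - 1\<close>. Its discriminant \<open>(1 - \<zeta>)\<^sup>2 + 4 (1 + \<zeta>)\<close> is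
  \<open>4 + (1 + \<zeta>)\<^sup>2\<close>, and its two roots have opposite signs.\<close>

lemma rfd_step_size_matern_2:
  assumes "s > 0" "\<sigma>\<^sup>2 > 0" "\<Theta> > 0"
  defines "\<zeta> \<equiv> sqrt 5 / (3 * s * \<Theta>)"
  shows "is_rfd_step_size (matern 2 s \<sigma>) \<Theta> \<eta> \<longleftrightarrow>
    \<eta> = s / sqrt 5 * (((1 - \<zeta>) + sqrt (4 + (1 + \<zeta>)\<^sup>2)) / (2 * (1 + \<zeta>)))"
proof -
  define a where "a = sqrt 5 / s"
  define D where "D = sqrt (4 + (1 + \<zeta>)\<^sup>2)"
  define t where "t = ((1 - \<zeta>) + D) / (2 * (1 + \<zeta>))"
  define u where "u = (D - (1 - \<zeta>)) / (2 * (1 + \<zeta>))"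
  have a: "a > 0" using assms by (simp add: a_def)
  have \<zeta>: "\<zeta> > 0" using assms by simp
  have a\<zeta>: "a = 3 * \<Theta> * \<zeta>" using assms by (simp add: a_def \<zeta>_def)
  have D2: "D\<^sup>2 = 4 + (1 + \<zeta>)\<^sup>2" by (simp add: D_def)
  have "\<bar>1 - \<zeta>\<bar> < D"
    unfolding D_def by (rule real_less_rsqrt) (use \<zeta> in \<open>simp add: power2_eq_square algebra_simps\<close>)
  hence t: "t > 0" and u: "u > 0" using \<zeta> by (auto simp: t_def u_def)
  have factor: "(1 + \<zeta>) * ((x - t) * (x + u)) = (1 + \<zeta>) * x\<^sup>2 - (1 - \<zeta>) * x - 1" for x
  proof -
    have t2: "2 * (1 + \<zeta>) * t = (1 - \<zeta>) + D" and u2: "2 * (1 + \<zeta>) * u = D - (1 - \<zeta>)"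
      using \<zeta> by (simp_all add: t_def u_def)
    have tu: "(1 + \<zeta>) * (t - u) = 1 - \<zeta>"
      using t2 u2 by (simp add: algebra_simps)
    have "4 * (1 + \<zeta>) * ((1 + \<zeta>) * (t * u)) = (2 * (1 + \<zeta>) * t) * (2 * (1 + \<zeta>) * u)"
      by (simp add: algebra_simps)
    also have "\<dots> = ((1 - \<zeta>) + D) * (D - (1 - \<zeta>))"
      by (simp only: t2 u2)
    also have "\<dots> = 4 * (1 + \<zeta>) * 1"
      using D2 by (simp add: algebra_simps power2_eq_square)
    finally have "(1 + \<zeta>) * (t * u) = 1" using \<zeta> by simp
    have "(1 + \<zeta>) * ((x - t) * (x + u)) = (1 + \<zeta>) * x\<^sup>2 - ((1 + \<zeta>) * (t - u)) * x - (1 + \<zeta>) * (t * u)"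
      by (simp add: algebra_simps power2_eq_square)
    thus ?thesis by (simp only: tu \<open>(1 + \<zeta>) * (t * u) = 1\<close>)
  qed
  let ?G' = "\<lambda>y. exp (- a * y) * (\<Theta> * ((1 + \<zeta>) * ((a * y - t) * (a * y + u))))"
  note obj = rfd_objective_matern_2[OF assms(1,2), folded a_def]
  have t_eq: "s / sqrt 5 * (((1 - \<zeta>) + sqrt (4 + (1 + \<zeta>)\<^sup>2)) / (2 * (1 + \<zeta>))) = t / a"
    by (simp add: t_def a_def D_def mult.commute)
  show ?thesis
    unfolding is_rfd_step_size_def t_eq
  proof (rule is_arg_min_iff_sign_change)
    show "t / a > 0" using t a by simp
    show "rfd_objective (matern 2 s \<sigma>) \<Theta> y < rfd_objective (matern 2 s \<sigma>) \<Theta> (- y)" if "y > 0" for y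
    proof -
      have "y * (exp (- a * y) * (1 + a * y)) * \<Theta> > 0"
        using that assms a by (intro mult_pos_pos add_pos_pos) auto
      thus ?thesis using that by (simp add: obj)
    qed
    show "rfd_objective (matern 2 s \<sigma>) \<Theta> y =
        - exp (- a * y) * (1 + (a + \<Theta>) * y + (a\<^sup>2 / 3 + a * \<Theta>) * y\<^sup>2)" if "y \<ge> 0" for y
      using that by (simp add: obj algebra_simps power2_eq_square)
    show "((\<lambda>y. - exp (- a * y) * (1 + (a + \<Theta>) * y + (a\<^sup>2 / 3 + a * \<Theta>) * y\<^sup>2))
        has_real_derivative ?G' y) (at y)" for y
      unfolding factor
      by (auto intro!: derivative_eq_intros simp: a\<zeta> algebra_simps power2_eq_square)
    show "?G' y < 0" if "0 < y" "y < t / a" for y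
    proof -
      have "a * y < t" "a * y > 0" using that a by (simp_all add: field_simps)
      hence "(a * y - t) * (a * y + u) < 0" using u by (intro mult_neg_pos) auto
      thus ?thesis using \<zeta> assms(3) by (simp add: mult_less_0_iff zero_less_mult_iff)
    qed
    show "?G' y > 0" if "t / a < y" for y
    proof -
      have "a * y > t" using that a by (simp add: field_simps)
      hence "(a * y - t) * (a * y + u) > 0" using t u by (intro mult_pos_pos) auto
      thus ?thesis using \<zeta> assms(3) by simp
    qed
  qed
qed

theorem theoremC7:
  fixes M :: "'w measure"
    and J :: "'w \<Rightarrow> real ^ 'n \<Rightarrow> real"
    and \<mu> s \<sigma> \<Theta> :: real
    and p :: nat
    and w :: "real ^ 'n"
    and \<omega> :: 'w
  assumes "s > 0" and "\<sigma>\<^sup>2 > 0" and "p \<in> {1, 2}"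
    and "isotropic_gaussian_function M J \<mu> (matern p s \<sigma>)"
    and "\<omega> \<in> space M"
    and "J \<omega> w < \<mu>" and "gradient (J \<omega>) w \<noteq> 0"
    and "\<Theta> = norm (gradient (J \<omega>) w) / (\<mu> - J \<omega> w)"
  shows "\<Theta> > 0 \<and>
    (p = 1 \<longrightarrow> (\<forall>\<eta>. is_rfd_step_size (matern p s \<sigma>) \<Theta> \<eta> \<longleftrightarrow>
       \<eta> = s / sqrt 3 * (1 / (1 + sqrt 3 / (s * \<Theta>))))) \<and>
    (p = 2 \<longrightarrow> (let \<zeta> = sqrt 5 / (3 * s * \<Theta>) in
       \<forall>\<eta>. is_rfd_step_size (matern p s \<sigma>) \<Theta> \<eta> \<longleftrightarrow>
         \<eta> = s / sqrt 5 * (((1 - \<zeta>) + sqrt (4 + (1 + \<zeta>)\<^sup>2)) / (2 * (1 + \<zeta>)))))"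
proof -
  have \<Theta>: "\<Theta> > 0" using assms(6-8) by simp
  show ?thesis
    unfolding Let_def
    using \<Theta> rfd_step_size_matern_1[OF assms(1,2) \<Theta>] rfd_step_size_matern_2[OF assms(1,2) \<Theta>]
    by blast
qed

end
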